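(* If $\mathrm{M}$ is a universal metric space, then its set of distances $\operatorname{dist}(\mathrm{M})$ satisfies the 4-values condition.
   Context: For a metric space $\mathrm{M}=(M;d)$ let $\operatorname{dist}(\mathrm{M})=\{d(x,y)\mid x,y\in M\}$. A metric space $\mathrm{M}$ is homogeneous if for every isometry (distance preserving map) $f$ of a finite subspace of $\mathrm{M}$ to a subspace of $\mathrm{M}$ there exists an isometry of $\mathrm{M}$ onto $\mathrm{M}$ extending $f$. A metric space $\mathrm{M}$ is universal if it is homogeneous and isometrically embeds every finite metric space $\mathrm{F}$ with $\operatorname{dist}(\mathrm{F})\subseteq \operatorname{dist}(\mathrm{M})$. A set $R\subseteq\mathbb{R}_{\geq 0}$ satisfies the 4-values condition if for all pairs of metric spaces $\mathrm{A}=(\{x,y,z\};d_\mathrm{A})$ and $\mathrm{B}=(\{u,y,z\};d_\mathrm{B})$ ($x,y,z,u$ distinct points) with $\operatorname{dist}(\mathrm{A})\cup\operatorname{dist}(\mathrm{B})\subseteq R$ and $d_\mathrm{A}(y,z)=d_\mathrm{B}(y,z)$ there exists a metric space $\mathrm{C}=(\{x,y,z,u\};d_\mathrm{C})$ with $\operatorname{dist}(\mathrm{C})\subseteq R$ such that the subspace of $\mathrm{C}$ induced by $\{x,y,z\}$ is $\mathrm{A}$ and the subspace of $\mathrm{C}$ induced by $\{u,y,z\}$ is $\mathrm{B}$. *)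

theory Defs
  imports "HOL-Analysis.Analysis"
begin

definition dist_set :: "'a set \<Rightarrow> ('a \<Rightarrow> 'a \<Rightarrow> real) \<Rightarrow> real set" where
  "dist_set M d = {d x y | x y. x \<in> M \<and> y \<in> M}"

definition isometric_map ::
  "'a set \<Rightarrow> ('a \<Rightarrow> 'a \<Rightarrow> real) \<Rightarrow> 'b set \<Rightarrow> ('b \<Rightarrow> 'b \<Rightarrow> real) \<Rightarrow> ('a \<Rightarrow> 'b) \<Rightarrow> bool" where
  "isometric_map A d B e f \<longleftrightarrow> f \<in> A \<rightarrow> B \<and> (\<forall>x\<in>A. \<forall>y\<in>A. e (f x) (f y) = d x y)"

definition homogeneous_metric :: "'a set \<Rightarrow> ('a \<Rightarrow> 'a \<Rightarrow> real) \<Rightarrow> bool" where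
  "homogeneous_metric M d \<longleftrightarrow>
    (\<forall>A f. finite A \<and> A \<subseteq> M \<and> isometric_map A d M d f \<longrightarrow>
      (\<exists>g. isometric_map M d M d g \<and> g ` M = M \<and> (\<forall>x\<in>A. g x = f x)))"

text \<open>A definition cannot quantify over types, so finite metric spaces range over those with
  natural numbers as points; these represent every finite metric space up to isometry
  (\<open>universal_metricD\<close> below).\<close>

definition universal_metric :: "'a set \<Rightarrow> ('a \<Rightarrow> 'a \<Rightarrow> real) \<Rightarrow> bool" where
  "universal_metric M d \<longleftrightarrow>
    homogeneous_metric M d \<and>
    (\<forall>(F :: nat set) e. finite F \<and> Metric_space F e \<and> dist_set F e \<subseteq> dist_set M d \<longrightarrow>
      (\<exists>f. isometric_map F e M d f))"

text \<open>The four points are likewise natural numbers; \<open>four_values_conditionD\<close> below gives the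
  condition for points of an arbitrary type.\<close>

definition four_values_condition :: "real set \<Rightarrow> bool" where
  "four_values_condition R \<longleftrightarrow>
    R \<subseteq> {0..} \<and>
    (\<forall>(x::nat) y z u dA dB.
      distinct [x, y, z, u] \<and>
      Metric_space {x, y, z} dA \<and> Metric_space {u, y, z} dB \<and>
      dist_set {x, y, z} dA \<union> dist_set {u, y, z} dB \<subseteq> R \<and>
      dA y z = dB y z \<longrightarrow>
      (\<exists>dC. Metric_space {x, y, z, u} dC \<and> dist_set {x, y, z, u} dC \<subseteq> R \<and>
        (\<forall>p\<in>{x, y, z}. \<forall>q\<in>{x, y, z}. dC p q = dA p q) \<and>
        (\<forall>p\<in>{u, y, z}. \<forall>q\<in>{u, y, z}. dC p q = dB p q)))"

lemma Metric_space_pullback: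
  assumes "Metric_space B e" "inj_on h A" "h ` A \<subseteq> B"
  shows "Metric_space A (\<lambda>x y. e (h x) (h y))"
proof -
  interpret Metric_space B e by fact
  show ?thesis
    using assms(2,3) by unfold_locales (auto simp: commute inj_on_eq_iff image_subset_iff triangle)
qed

lemma dist_set_pullback: "dist_set A (\<lambda>x y. e (h x) (h y)) = dist_set (h ` A) e"
  unfolding dist_set_def by blast

lemma universal_metricD:
  fixes F :: "'b set"
  assumes "universal_metric M d" "finite F" "Metric_space F e" "dist_set F e \<subseteq> dist_set M d"
  shows "\<exists>f. isometric_map F e M d f"
proof -
  obtain h :: "nat \<Rightarrow> 'b" and n where h: "F = h ` {i. i < n}" "inj_on h {i. i < n}"
    using finite_imp_nat_seg_image_inj_on[OF assms(2)] by blast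
  let ?e = "\<lambda>i j. e (h i) (h j)"
  have "Metric_space {i. i < n} ?e"
    by (rule Metric_space_pullback[OF assms(3) h(2)]) (simp add: h(1))
  moreover have "dist_set {i. i < n} ?e \<subseteq> dist_set M d"
    using assms(4) by (simp only: dist_set_pullback h(1))
  ultimately obtain f where f: "isometric_map {i. i < n} ?e M d f"
    using assms(1) unfolding universal_metric_def by (metis finite_Collect_less_nat)
  have "isometric_map F e M d (f \<circ> the_inv_into {i. i < n} h)"
    using f unfolding isometric_map_def h(1) by (auto simp: the_inv_into_f_f[OF h(2)] Pi_iff)
  then show ?thesis by blast
qed

lemma four_values_conditionD:
  fixes x y z u :: 'b
  assumes R: "four_values_condition R"
    and dist: "distinct [x, y, z, u]"
    and A: "Metric_space {x, y, z} dA" and B: "Metric_space {u, y, z} dB"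
    and sub: "dist_set {x, y, z} dA \<union> dist_set {u, y, z} dB \<subseteq> R"
    and eq: "dA y z = dB y z"
  shows "\<exists>dC. Metric_space {x, y, z, u} dC \<and> dist_set {x, y, z, u} dC \<subseteq> R \<and>
    (\<forall>p\<in>{x, y, z}. \<forall>q\<in>{x, y, z}. dC p q = dA p q) \<and>
    (\<forall>p\<in>{u, y, z}. \<forall>q\<in>{u, y, z}. dC p q = dB p q)"
proof -
  define h :: "nat \<Rightarrow> 'b" where "h = (!) [x, y, z, u]"
  define g :: "'b \<Rightarrow> nat"
    where "g p = (if p = x then 0 else if p = y then 1 else if p = z then 2 else 3)" for p
  have h: "h 0 = x" "h 1 = y" "h 2 = z" "h 3 = u" "h (Suc 0) = y" by (simp_all add: h_def)
  have g: "g x = 0" "g y = 1" "g z = 2" "g u = 3" using dist by (auto simp: g_def)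
  let ?dA = "\<lambda>i j. dA (h i) (h j)" and ?dB = "\<lambda>i j. dB (h i) (h j)"
  have "Metric_space {0, 1, 2} ?dA"
    by (rule Metric_space_pullback[OF A]) (use dist in \<open>auto simp: h\<close>)
  moreover have "Metric_space {3, 1, 2} ?dB"
    by (rule Metric_space_pullback[OF B]) (use dist in \<open>auto simp: h\<close>)
  moreover have "dist_set {0, 1, 2} ?dA \<union> dist_set {3, 1, 2} ?dB \<subseteq> R"
    using sub by (simp only: dist_set_pullback image_insert image_empty h)
  moreover have "?dA 1 2 = ?dB 1 2" "distinct [0, 1, 2, 3::nat]" using eq by (simp_all add: h)
  ultimately obtain dC where C: "Metric_space {0, 1, 2, 3} dC" "dist_set {0, 1, 2, 3} dC \<subseteq> R"
      "\<forall>p\<in>{0, 1, 2}. \<forall>q\<in>{0, 1, 2}. dC p q = ?dA p q"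
      "\<forall>p\<in>{3, 1, 2}. \<forall>q\<in>{3, 1, 2}. dC p q = ?dB p q"
    using R unfolding four_values_condition_def by blast
  let ?dC = "\<lambda>p q. dC (g p) (g q)"
  have "Metric_space {x, y, z, u} ?dC"
    by (rule Metric_space_pullback[OF C(1)]) (auto simp: g)
  moreover have "dist_set {x, y, z, u} ?dC \<subseteq> R"
    using C(2) by (simp only: dist_set_pullback image_insert image_empty g)
  moreover have "\<forall>p\<in>{x, y, z}. \<forall>q\<in>{x, y, z}. ?dC p q = dA p q"
    using C(3) by (simp add: g h)
  moreover have "\<forall>p\<in>{u, y, z}. \<forall>q\<in>{u, y, z}. ?dC p q = dB p q"
    using C(4) by (simp add: g h)
  ultimately show ?thesis by (intro exI[of _ ?dC]) blast
qed

end

theory Submission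
  imports Defs
begin

text \<open>Two finite spaces \<open>A = {x, y, z}\<close> and \<open>B = {u, y, z}\<close> with distances in \<open>dist_set M d\<close>
  embed into \<open>M\<close> by universality. By homogeneity a self-isometry of \<open>M\<close> moves the copy of \<open>B\<close>
  until it agrees with the copy of \<open>A\<close> on the common points \<open>y\<close> and \<open>z\<close>
  (\<open>isometric_maps_made_to_agree\<close>), so together they map \<open>{x, y, z, u}\<close> into \<open>M\<close>. If the images
  of \<open>x\<close> and \<open>u\<close> differ, this map is injective and pulling back the metric of \<open>M\<close> gives the
  required amalgam.

  If they coincide, the pulled back function is only a pseudometric, but then \<open>u\<close> and \<open>x\<close> have the
  same distances to \<open>y\<close> and \<open>z\<close>. Hence it suffices to split \<open>x\<close> into two points at a
  positive distance \<open>r\<close> in \<open>dist_set M d\<close> that obeys the triangle inequality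
  (\<open>Metric_space_split_point\<close>), and the smaller of the distances from \<open>x\<close> to \<open>y\<close> and to \<open>z\<close> serves
  as \<open>r\<close>: no distance outside the given two triangles is used.\<close>

lemma isometric_map_inj_on:
  assumes "Metric_space A d" "Metric_space B e" "isometric_map A d B e f"
  shows "inj_on f A"
proof (rule inj_onI)
  fix p q
  assume "p \<in> A" "q \<in> A" "f p = f q"
  moreover from this have "d p q = 0"
    using assms(3) Metric_space.zero[OF assms(2), of "f q" "f q"]
    by (metis PiE isometric_map_def)
  ultimately show "p = q"
    using Metric_space.zero[OF assms(1)] by blast
qed

text \<open>The two images of \<open>A \<inter> B\<close> are isometric finite subspaces of \<open>M\<close>, so homogeneity provides a
  self-isometry of \<open>M\<close> carrying the image under \<open>g\<close> to the image under \<open>f\<close>.\<close>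

lemma isometric_maps_made_to_agree:
  assumes M: "Metric_space M d" "homogeneous_metric M d"
    and B: "Metric_space B dB"
    and f: "isometric_map A dA M d f" and g: "isometric_map B dB M d g"
    and fin: "finite (A \<inter> B)"
    and eq: "\<And>p q. p \<in> A \<inter> B \<Longrightarrow> q \<in> A \<inter> B \<Longrightarrow> dA p q = dB p q"
  obtains g' where "isometric_map B dB M d g'" "\<And>p. p \<in> A \<inter> B \<Longrightarrow> g' p = f p"
proof -
  have "inj_on g B"
    by (rule isometric_map_inj_on[OF B M(1) g])
  then have inv: "the_inv_into B g (g p) = p" if "p \<in> B" for p
    using that by (rule the_inv_into_f_f)
  have "isometric_map (g ` (A \<inter> B)) d M d (f \<circ> the_inv_into B g)"
    using f g eq by (auto simp: isometric_map_def inv Pi_iff)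
  moreover have "g ` (A \<inter> B) \<subseteq> M"
    using g by (auto simp: isometric_map_def)
  ultimately obtain k where k: "isometric_map M d M d k"
    and kf: "\<forall>m\<in>g ` (A \<inter> B). k m = (f \<circ> the_inv_into B g) m"
    using M(2) fin unfolding homogeneous_metric_def by (meson finite_imageI)
  show thesis
  proof
    show "isometric_map B dB M d (k \<circ> g)"
      using k g by (auto simp: isometric_map_def Pi_iff)
    show "(k \<circ> g) p = f p" if "p \<in> A \<inter> B" for p
      using kf that by (simp add: inv)
  qed
qed

text \<open>Splitting the point \<open>x\<close> into \<open>x\<close> and a twin \<open>u\<close> at distance \<open>r\<close>. Triangles containing at most
  one twin are inherited from \<open>A\<close>; a triangle on both twins and \<open>p\<close> is isosceles with base \<open>r\<close>
  and legs \<open>e x p\<close>, whence the bound on \<open>r\<close>.\<close>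

lemma Metric_space_split_point:
  assumes A: "Metric_space A e" and "x \<in> A" "u \<notin> A"
    and "r > 0" and le: "\<And>p. p \<in> A \<Longrightarrow> p \<noteq> x \<Longrightarrow> r \<le> 2 * e x p"
  shows "Metric_space (insert u A)
    (\<lambda>p q. if {p, q} = {x, u} then r else e (if p = u then x else p) (if q = u then x else q))"
    (is "Metric_space _ ?c")
proof
  interpret Metric_space A e by fact
  show "0 \<le> ?c p q" for p q
    using \<open>r > 0\<close> by simp
  show "?c p q = ?c q p" for p q
    by (simp add: commute insert_commute)
  show "?c p q = 0 \<longleftrightarrow> p = q" if "p \<in> insert u A" "q \<in> insert u A" for p q
    using that \<open>x \<in> A\<close> \<open>u \<notin> A\<close> \<open>r > 0\<close> by (auto simp: doubleton_eq_iff)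
  show "?c p s \<le> ?c p q + ?c q s"
    if "p \<in> insert u A" "q \<in> insert u A" "s \<in> insert u A" for p q s
  proof -
    have "e x x = 0" "x \<noteq> u"
      using \<open>x \<in> A\<close> \<open>u \<notin> A\<close> by auto
    then show ?thesis
      using that \<open>x \<in> A\<close> \<open>u \<notin> A\<close> \<open>r > 0\<close> le[of q] triangle[of p q s] triangle[of x q s]
        triangle[of p x s] triangle[of p q x] commute[of q x]
      by (auto simp: doubleton_eq_iff)
  qed
qed

theorem theorem2:
  fixes M :: "'a set" and d :: "'a \<Rightarrow> 'a \<Rightarrow> real"
  assumes "Metric_space M d" and "universal_metric M d"
  shows "four_values_condition (dist_set M d)"
  unfolding four_values_condition_def
proof (intro conjI allI impI)
  interpret Metric_space M d by fact
  show "dist_set M d \<subseteq> {0..}"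
    by (auto simp: dist_set_def)
  fix x y z u :: nat and dA dB
  assume *: "distinct [x, y, z, u] \<and>
      Metric_space {x, y, z} dA \<and> Metric_space {u, y, z} dB \<and>
      dist_set {x, y, z} dA \<union> dist_set {u, y, z} dB \<subseteq> dist_set M d \<and> dA y z = dB y z"
  then have dist: "x \<noteq> y" "x \<noteq> z" "x \<noteq> u" "y \<noteq> z" "y \<noteq> u" "z \<noteq> u"
    and A: "Metric_space {x, y, z} dA" and B: "Metric_space {u, y, z} dB"
    and subA: "dist_set {x, y, z} dA \<subseteq> dist_set M d"
    and subB: "dist_set {u, y, z} dB \<subseteq> dist_set M d"
    and yz: "dA y z = dB y z"
    by auto
  interpret A: Metric_space "{x, y, z}" dA by (fact A)
  interpret B: Metric_space "{u, y, z}" dB by (fact B)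
  obtain f where f: "isometric_map {x, y, z} dA M d f"
    using universal_metricD[OF assms(2) _ A subA] by auto
  obtain g0 where g0: "isometric_map {u, y, z} dB M d g0"
    using universal_metricD[OF assms(2) _ B subB] by auto
  have eq: "dA p q = dB p q" if "p \<in> {x, y, z} \<inter> {u, y, z}" "q \<in> {x, y, z} \<inter> {u, y, z}" for p q
    using that dist yz A.commute[of y z] B.commute[of y z] by auto
  have hom: "homogeneous_metric M d"
    using assms(2) by (simp add: universal_metric_def)
  obtain g where g: "isometric_map {u, y, z} dB M d g"
    and agree: "\<And>p. p \<in> {x, y, z} \<inter> {u, y, z} \<Longrightarrow> g p = f p"
    using isometric_maps_made_to_agree[OF assms(1) hom B f g0 _ eq] by auto
  have gf: "g y = f y" "g z = f z"
    using agree by auto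
  show "\<exists>dC. Metric_space {x, y, z, u} dC \<and> dist_set {x, y, z, u} dC \<subseteq> dist_set M d \<and>
        (\<forall>p\<in>{x, y, z}. \<forall>q\<in>{x, y, z}. dC p q = dA p q) \<and>
        (\<forall>p\<in>{u, y, z}. \<forall>q\<in>{u, y, z}. dC p q = dB p q)"
  proof (cases "f x = g u")
    case False
    define h where "h = f(u := g u)"
    have hA: "h p = f p" if "p \<in> {x, y, z}" for p
      using that dist by (auto simp: h_def)
    have hB: "h p = g p" if "p \<in> {u, y, z}" for p
      using that dist gf by (auto simp: h_def)
    have "inj_on f {x, y, z}" "inj_on g {u, y, z}"
      using isometric_map_inj_on A B f g assms(1) by blast+
    then have inj: "inj_on h {x, y, z, u}"
      using False dist gf by (auto simp: h_def inj_on_def)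
    have sub: "h ` {x, y, z, u} \<subseteq> M"
      using f g by (auto simp: h_def isometric_map_def)
    let ?dC = "\<lambda>p q. d (h p) (h q)"
    have "Metric_space {x, y, z, u} ?dC"
      by (rule Metric_space_pullback[OF assms(1) inj sub])
    moreover have "dist_set {x, y, z, u} ?dC \<subseteq> dist_set M d"
      using sub by (simp only: dist_set_pullback) (auto simp: dist_set_def)
    moreover have "\<forall>p\<in>{x, y, z}. \<forall>q\<in>{x, y, z}. ?dC p q = dA p q"
      using f unfolding isometric_map_def by (metis hA)
    moreover have "\<forall>p\<in>{u, y, z}. \<forall>q\<in>{u, y, z}. ?dC p q = dB p q"
      using g unfolding isometric_map_def by (metis hB)
    ultimately show ?thesis
      by (intro exI[of _ ?dC]) blast
  next
    case True
    then have twin: "dA x y = dB u y" "dA x z = dB u z"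
      using f g gf by (auto simp: isometric_map_def)
    let ?r = "min (dA x y) (dA x z)"
    let ?dC = "\<lambda>p q. if {p, q} = {x, u} then ?r
      else dA (if p = u then x else p) (if q = u then x else q)"
    have pos: "dA x y > 0" "dA x z > 0"
      using dist by auto
    then have bounds: "?r \<le> 2 * dA x y" "?r \<le> 2 * dA x z"
      by linarith+
    have "Metric_space (insert u {x, y, z}) ?dC"
      by (rule Metric_space_split_point[OF A]) (use dist pos bounds in auto)
    then have "Metric_space {x, y, z, u} ?dC"
      by (simp only: insert_commute)
    moreover have "dist_set {x, y, z, u} ?dC \<subseteq> dist_set M d"
    proof -
      have in_R: "dA p q \<in> dist_set M d" if "p \<in> {x, y, z}" "q \<in> {x, y, z}" for p q
        using subA that unfolding dist_set_def[of "{x, y, z}"] by blast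
      then have "?r \<in> dist_set M d"
        by (simp add: min_def)
      then have "?dC p q \<in> dist_set M d" if "p \<in> {x, y, z, u}" "q \<in> {x, y, z, u}" for p q
        using in_R[of "if p = u then x else p" "if q = u then x else q"] that by auto
      then show ?thesis
        unfolding dist_set_def[of "{x, y, z, u}"] by blast
    qed
    moreover have "\<forall>p\<in>{x, y, z}. \<forall>q\<in>{x, y, z}. ?dC p q = dA p q"
      using dist by (auto simp: doubleton_eq_iff)
    moreover have "\<forall>p\<in>{u, y, z}. \<forall>q\<in>{u, y, z}. ?dC p q = dB p q"
      using dist twin yz A.commute B.commute by (auto simp: doubleton_eq_iff)
    ultimately show ?thesis
      by (intro exI[of _ ?dC]) blast
  qed
qed

end
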